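(* Let $k\ge3$ be an integer, let $q\ge 2$ and $b$ be integers with $\gcd(b,q-1)=1$, and let $\ell$ be an integer with $0<\ell<b$. Set $$K=\left\lfloor\frac{\log k}{\log q}\right\rfloor+1,\qquad \eta_0=\frac{1}{\log(q)\,(K+(k+1)b)\,q^{(k+1)(K+b(k+1))}}.$$ Then, as $\rho\to\infty$ ($\rho$ an integer), $$\frac{1}{q^{(k+1)\rho}}\sum_{\substack{0\le n<q^\rho\\0\le h_0,\dots,h_{k-1}<q^\rho}}\mathrm{e}\left(\frac{\ell}{b}\sum_{\mathbf w=(w_0,\dots,w_{k-1})\in\{0,1\}^k}(-1)^{s_2(w)}s_q(n+\mathbf w\cdot\mathbf h)\right)\ll q^{-\eta_0\rho},$$ and likewise $$\frac{1}{q^{(k+1)\rho}}\sum_{\substack{0\le n<q^\rho\\0\le h_0,\dots,h_{k-1}<q^\rho}}\mathrm{e}\left(\frac{\ell}{b}\sum_{\mathbf w=(w_0,\dots,w_{k-1})\in\{0,1\}^k}(-1)^{s_2(w)}s_q^{\rho}(n+\mathbf w\cdot\mathbf h)\right)\ll q^{-\eta_0\rho}.$$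
   Context: $\mathrm{e}(t)=e^{2\pi i t}$. For an integer $n\ge 0$ with base-$q$ expansion $n=\sum_{i\ge0}n_iq^i$, $n_i\in\{0,\dots,q-1\}$, put $s_q(n)=\sum_{i\ge 0}n_i$. For an integer $\rho>0$, $s_q^\rho(n)=s_q(n')$ where $0\le n'<q^\rho$ and $n'\equiv n\pmod{q^\rho}$. For $\mathbf w=(w_0,\dots,w_{k-1})\in\{0,1\}^k$, $w=\sum_i w_i2^i$, so $s_2(w)=w_0+\cdots+w_{k-1}$; and $\mathbf w\cdot\mathbf h=\sum_{i=0}^{k-1}w_ih_i$ with $\mathbf h=(h_0,\dots,h_{k-1})$. The bound $\ll$ is for the absolute value of the left side, with an implied constant that does not depend on $\rho$ (it may depend on $k,q,b,\ell$). *)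

theory Defs
  imports "HOL-Analysis.Analysis" "HOL-Library.Landau_Symbols" "HOL-Library.FuncSet"
begin

definition e2pi :: "real \<Rightarrow> complex" where
  "e2pi t = exp (2 * complex_of_real pi * \<i> * complex_of_real t)"

text \<open>
  The \<open>i\<close>-th base-\<open>q\<close> digit of \<open>n\<close> is \<open>n div q ^ i mod q\<close>; it vanishes unless \<open>q ^ i \<le> n\<close>,
  so the sum below runs over a finite set (for \<open>q \<ge> 2\<close>) containing all nonzero digits.
\<close>
definition digit_sum :: "nat \<Rightarrow> nat \<Rightarrow> nat" where
  "digit_sum q n = (\<Sum>i | q ^ i \<le> n. n div q ^ i mod q)"

definition trunc_digit_sum :: "nat \<Rightarrow> nat \<Rightarrow> nat \<Rightarrow> nat" where
  "trunc_digit_sum q \<rho> n = digit_sum q (n mod q ^ \<rho>)"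

lemma finite_pow_le:
  fixes q n :: nat
  assumes "q \<ge> 2"
  shows "finite {i. q ^ i \<le> n}"
proof -
  have "i \<le> n" if "q ^ i \<le> n" for i
  proof -
    have "i < 2 ^ i" by (rule less_exp)
    also have "(2::nat) ^ i \<le> q ^ i" using assms by (intro power_mono) auto
    finally show ?thesis using that by simp
  qed
  then have "{i. q ^ i \<le> n} \<subseteq> {..n}" by auto
  then show ?thesis by (rule finite_subset) simp
qed

lemma digit_sum_0 [simp]: "q \<ge> 2 \<Longrightarrow> digit_sum q 0 = 0"
  by (simp add: digit_sum_def)

lemma digit_sum_rec:
  assumes q: "q \<ge> 2"
  shows "digit_sum q n = n mod q + digit_sum q (n div q)"
proof (cases "n = 0")
  case True
  then show ?thesis using q by simp
next
  case False
  have *: "q ^ Suc i \<le> n \<longleftrightarrow> q ^ i \<le> n div q" for i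
    using q by (simp add: less_eq_div_iff_mult_less_eq mult.commute)
  have set_eq: "{i. q ^ i \<le> n} = insert 0 (Suc ` {i. q ^ i \<le> n div q})"
  proof (rule set_eqI)
    fix i
    show "i \<in> {i. q ^ i \<le> n} \<longleftrightarrow> i \<in> insert 0 (Suc ` {i. q ^ i \<le> n div q})"
      using False * by (cases i) (auto simp del: power_Suc)
  qed
  have "digit_sum q n = n mod q + (\<Sum>i\<in>Suc ` {i. q ^ i \<le> n div q}. n div q ^ i mod q)"
    unfolding digit_sum_def set_eq using finite_pow_le[OF q] by (subst sum.insert) auto
  also have "(\<Sum>i\<in>Suc ` {i. q ^ i \<le> n div q}. n div q ^ i mod q) = digit_sum q (n div q)"
    unfolding digit_sum_def
    by (subst sum.reindex) (auto simp: div_mult2_eq intro!: sum.cong)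
  finally show ?thesis .
qed

end

theory Submission
  imports Defs
begin

text \<open>
  Splitting off the lowest \<open>L = K + (k + 1) * b\<close> digits of \<open>n, h\<^sub>0, \<dots>\<close> turns the sum into
  \<open>D = q ^ ((k + 1) * L)\<close> sums of the same shape, perturbed by carries \<open>r w \<le> k\<close>. Zeros in the lowest
  \<open>K\<close> of these digits absorb the incoming carries. In each of the following \<open>b\<close> groups of \<open>k + 1\<close> digits
  one may place either zeros or a pattern for which \<open>n + w \<cdot> h\<close> is \<open>q ^ k\<close> at \<open>w = (1, \<dots>, 1)\<close> and smaller
  elsewhere; the pattern changes the phase by \<open>\<plusminus> l * (q - 1) / b\<close>, which is not an integer. Filling the
  first \<open>j\<close> groups, for \<open>j < b\<close>, gives \<open>b\<close> choices with no outgoing carry whose phases form a vanishing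
  geometric sum. Hence each \<open>L\<close> digits save a factor of \<open>1 - 1 / D \<le> exp (- 1 / D)\<close>.
\<close>

section \<open>Sums of digits\<close>

lemma digit_sum_less:
  assumes "q \<ge> 2" "n < q"
  shows "digit_sum q n = n"
  using digit_sum_rec[OF assms(1), of n] assms by simp

lemma digit_sum_split:
  assumes q: "q \<ge> 2" and "u < q ^ m"
  shows "digit_sum q (u + q ^ m * v) = digit_sum q u + digit_sum q v"
  using assms(2)
proof (induction m arbitrary: u)
  case 0
  then show ?case using q by simp
next
  case (Suc m)
  have eq: "u + q ^ Suc m * v = u + q * (q ^ m * v)"
    by simp
  have md: "(u + q ^ Suc m * v) mod q = u mod q"
    unfolding eq by simp
  have dv: "(u + q ^ Suc m * v) div q = u div q + q ^ m * v"
    unfolding eq using q by simp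
  have "u div q < q ^ m"
    using Suc.prems q by (simp add: less_mult_imp_div_less mult.commute)
  from Suc.IH[OF this] show ?case
    using digit_sum_rec[OF q, of "u + q ^ Suc m * v"] digit_sum_rec[OF q, of u] md dv by simp
qed

lemma digit_sum_mod_div:
  assumes q: "q \<ge> 2"
  shows "digit_sum q n = trunc_digit_sum q m n + digit_sum q (n div q ^ m)"
proof -
  have "n mod q ^ m < q ^ m"
    using q by simp
  from digit_sum_split[OF q this, of "n div q ^ m"] show ?thesis
    by (simp add: trunc_digit_sum_def)
qed

text \<open>Together with \<open>digit_sum_mod_div\<close> this gives both digit functions the
  recursion that \<open>carry_sum_bound\<close> asks for: the lowest \<open>m\<close> digits
  contribute a truncated digit sum, and the quotient is treated in the same way.\<close>

lemma trunc_digit_sum_mod_div: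
  assumes q: "q \<ge> 2"
  shows "trunc_digit_sum q (m + j) n = trunc_digit_sum q m n + trunc_digit_sum q j (n div q ^ m)"
proof -
  have "n mod q ^ m < q ^ m"
    using q by simp
  moreover have "n mod q ^ (m + j) = n mod q ^ m + q ^ m * (n div q ^ m mod q ^ j)"
    unfolding power_add mod_mult2_eq by (rule add.commute)
  ultimately show ?thesis
    using digit_sum_split[OF q, of _ m "n div q ^ m mod q ^ j"] by (simp add: trunc_digit_sum_def)
qed

text \<open>Turns the exponent of the sign in the theorem into the plain coordinate sum, on which
  induction on the dimension works well.\<close>

lemma digit_sum_2_binary:
  assumes "\<And>i. i < k \<Longrightarrow> w i \<in> {0, 1::nat}"
  shows "digit_sum 2 (\<Sum>i<k. w i * 2 ^ i) = (\<Sum>i<k. w i)"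
  using assms
proof (induction k)
  case 0
  then show ?case by simp
next
  case (Suc k)
  have "w i * 2 ^ i \<le> 2 ^ i" if "i < k" for i
    using Suc.prems[of i] that by auto
  then have "(\<Sum>i<k. w i * 2 ^ i) \<le> (\<Sum>i<k. 2 ^ i)"
    by (intro sum_mono) auto
  also have "\<dots> < 2 ^ k"
    by (induction k) auto
  finally have lt: "(\<Sum>i<k. w i * 2 ^ i) < 2 ^ k" .
  have "w k < 2"
    using Suc.prems[of k] by auto
  with digit_sum_split[OF _ lt, of "w k"] Suc show ?case
    by (simp add: digit_sum_less mult.commute)
qed

text \<open>The factor is a repunit in base \<open>q ^ m\<close>, so the product consists of
  \<open>j\<close> copies of the \<open>m\<close>-digit block of \<open>v\<close> side by side. The
  size bound belongs to the induction, since it lets \<open>digit_sum_split\<close> separate the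
  last copy.\<close>

lemma digit_sum_repeat:
  assumes q: "q \<ge> 2" and v: "v < q ^ m"
  shows "(\<Sum>t<j. (q ^ m) ^ t) * v < (q ^ m) ^ j \<and>
         digit_sum q ((\<Sum>t<j. (q ^ m) ^ t) * v) = j * digit_sum q v"
proof (induction j)
  case 0
  then show ?case using q by simp
next
  case (Suc j)
  let ?G = "\<lambda>j. \<Sum>t<j. (q ^ m) ^ t"
  have eq: "?G (Suc j) * v = ?G j * v + q ^ (m * j) * v"
    unfolding power_mult by (simp add: add_mult_distrib)
  have lt: "?G j * v < q ^ (m * j)"
    using Suc by (simp add: power_mult)
  have "?G j * v + (q ^ m) ^ j * v < (q ^ m) ^ j * Suc v"
    using Suc by simp
  also have "\<dots> \<le> (q ^ m) ^ j * q ^ m"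
    using v by (intro mult_le_mono) auto
  finally have "?G (Suc j) * v < (q ^ m) ^ Suc j"
    unfolding eq power_mult power_Suc2 .
  moreover have "digit_sum q (?G (Suc j) * v) = Suc j * digit_sum q v"
    unfolding eq digit_sum_split[OF q lt] using Suc by simp
  ultimately show ?case by blast
qed

section \<open>The exponential\<close>

lemma e2pi_add: "e2pi (x + y) = e2pi x * e2pi y"
  by (simp add: e2pi_def distrib_left exp_add)

lemma norm_e2pi [simp]: "norm (e2pi x) = 1"
  by (simp add: e2pi_def norm_exp)

lemma e2pi_of_nat_mult: "e2pi (of_nat j * x) = e2pi x ^ j"
  by (simp add: e2pi_def exp_of_nat_mult[symmetric] mult_ac)

lemma e2pi_eq_1_iff: "e2pi x = 1 \<longleftrightarrow> x \<in> \<int>"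
  by (auto simp: e2pi_def exp_eq_1 Ints_def)

lemma geometric_sum_root_of_unity:
  fixes z :: "'a :: field"
  assumes "z \<noteq> 1" "z ^ b = 1"
  shows "(\<Sum>j<b. z ^ j) = 0"
  using assms by (simp add: geometric_sum)

section \<open>Sums with carries\<close>

abbreviation (input) cube :: "nat \<Rightarrow> (nat \<Rightarrow> nat) set" where
  "cube k \<equiv> {..<k} \<rightarrow>\<^sub>E {0, 1}"

text \<open>The function \<open>r\<close> holds the carries coming from lower digits; it depends on
  \<open>w\<close> because those of n + w.h do. Leaving \<open>s\<close> and \<open>g\<close> free
  covers both digit functions at once.\<close>

definition carry_sum ::
  "nat \<Rightarrow> ((nat \<Rightarrow> nat) \<Rightarrow> real) \<Rightarrow> (nat \<Rightarrow> nat) \<Rightarrow> nat \<Rightarrow> ((nat \<Rightarrow> nat) \<Rightarrow> nat) \<Rightarrow> complex"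
where
  "carry_sum k s g N r = (\<Sum>n<N. \<Sum>h\<in>{..<k} \<rightarrow>\<^sub>E {..<N}.
     e2pi (\<Sum>w\<in>cube k. s w * real (g (n + (\<Sum>i<k. w i * h i) + r w))))"

lemma bij_betw_mod_div:
  fixes M N :: nat
  assumes "M > 0"
  shows "bij_betw (\<lambda>(a, c). a + M * c) ({..<M} \<times> {..<N}) {..<M * N}"
proof (rule bij_betw_byWitness[where f' = "\<lambda>n. (n mod M, n div M)"])
  show "(\<lambda>(a, c). a + M * c) ` ({..<M} \<times> {..<N}) \<subseteq> {..<M * N}"
  proof clarsimp
    fix a c assume "a < M" "c < N"
    then have "a + M * c < M * Suc c" by simp
    also have "\<dots> \<le> M * N" using \<open>c < N\<close> by (intro mult_le_mono) auto
    finally show "a + M * c < M * N" .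
  qed
qed (use assms in \<open>auto simp: less_mult_imp_div_less mult.commute\<close>)

lemma sum_lessThan_mult:
  fixes M N :: nat
  assumes "M > 0"
  shows "(\<Sum>n<M * N. f n) = (\<Sum>a<M. \<Sum>c<N. f (a + M * c))"
  using sum.reindex_bij_betw[OF bij_betw_mod_div[OF assms], of f N]
  by (simp add: sum.cartesian_product case_prod_beta)

lemma sum_PiE_lessThan_mult:
  fixes M N k :: nat
  assumes "M > 0"
  shows "(\<Sum>h\<in>{..<k} \<rightarrow>\<^sub>E {..<M * N}. f h) =
         (\<Sum>a\<in>{..<k} \<rightarrow>\<^sub>E {..<M}. \<Sum>c\<in>{..<k} \<rightarrow>\<^sub>E {..<N}. f (\<lambda>i\<in>{..<k}. a i + M * c i))"
proof -
  have lt: "a + M * c < M * N" if "a < M" "c < N" for a c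
    using bij_betwE[OF bij_betw_mod_div[OF assms]] that by fastforce
  show ?thesis
    unfolding sum.cartesian_product
  proof (rule sum.reindex_bij_witness[where
        i = "\<lambda>(a, c). \<lambda>i\<in>{..<k}. a i + M * c i" and
        j = "\<lambda>h. (\<lambda>i\<in>{..<k}. h i mod M, \<lambda>i\<in>{..<k}. h i div M)"])
    fix h assume h: "h \<in> {..<k} \<rightarrow>\<^sub>E {..<M * N}"
    show eq: "(case (\<lambda>i\<in>{..<k}. h i mod M, \<lambda>i\<in>{..<k}. h i div M) of
        (a, c) \<Rightarrow> \<lambda>i\<in>{..<k}. a i + M * c i) = h"
      using h by (intro PiE_ext[of _ "{..<k}" "\<lambda>_. UNIV"]) (auto simp: PiE_iff)
    show "(case (\<lambda>i\<in>{..<k}. h i mod M, \<lambda>i\<in>{..<k}. h i div M) of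
        (a, c) \<Rightarrow> f (\<lambda>i\<in>{..<k}. a i + M * c i)) = f h"
      using arg_cong[OF eq, of f] by (simp only: case_prod_conv)
    have "h i < M * N" if "i < k" for i
      using PiE_mem[OF h] that by simp
    then show "(\<lambda>i\<in>{..<k}. h i mod M, \<lambda>i\<in>{..<k}. h i div M) \<in>
        ({..<k} \<rightarrow>\<^sub>E {..<M}) \<times> ({..<k} \<rightarrow>\<^sub>E {..<N})"
      using assms by (simp add: less_mult_imp_div_less mult.commute)
  next
    fix y assume "y \<in> ({..<k} \<rightarrow>\<^sub>E {..<M}) \<times> ({..<k} \<rightarrow>\<^sub>E {..<N})"
    then obtain a c where y: "y = (a, c)"
      and a: "a \<in> {..<k} \<rightarrow>\<^sub>E {..<M}" and c: "c \<in> {..<k} \<rightarrow>\<^sub>E {..<N}"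
      by blast
    have ac: "a i < M" "c i < N" if "i < k" for i
      using PiE_mem[OF a] PiE_mem[OF c] that by simp_all
    have "(\<lambda>i\<in>{..<k}. (a i + M * c i) mod M) = a"
      using a ac by (intro PiE_ext[of _ "{..<k}" "\<lambda>_. UNIV"]) (auto simp: PiE_iff)
    moreover have "(\<lambda>i\<in>{..<k}. (a i + M * c i) div M) = c"
      using c ac assms by (intro PiE_ext[of _ "{..<k}" "\<lambda>_. UNIV"]) (auto simp: PiE_iff)
    ultimately show "(\<lambda>i\<in>{..<k}. (case y of (a, c) \<Rightarrow> \<lambda>i\<in>{..<k}. a i + M * c i) i mod M,
        \<lambda>i\<in>{..<k}. (case y of (a, c) \<Rightarrow> \<lambda>i\<in>{..<k}. a i + M * c i) i div M) = y"
      unfolding y by (simp cong: restrict_cong)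
    show "(case y of (a, c) \<Rightarrow> \<lambda>i\<in>{..<k}. a i + M * c i) \<in> {..<k} \<rightarrow>\<^sub>E {..<M * N}"
      using lt ac unfolding y by simp
  qed
qed

text \<open>Write n = a + M c and h_i = x_i + M y_i. Then n + w.h + r w = (a + w.x + r w) + M (c +
  w.y). For fixed a and x the remainder of the first bracket gives a constant phase, and its
  quotient by M is the carry into the sum over c and y.\<close>

lemma carry_sum_split:
  assumes M: "M > 0"
    and g: "\<And>m. g m = g1 (m mod M) + g2 (m div M)"
  shows "carry_sum k s g (M * N) r =
    (\<Sum>n<M. \<Sum>h\<in>{..<k} \<rightarrow>\<^sub>E {..<M}.
       e2pi (\<Sum>w\<in>cube k. s w * real (g1 ((n + (\<Sum>i<k. w i * h i) + r w) mod M))) *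
       carry_sum k s g2 N (\<lambda>w. (n + (\<Sum>i<k. w i * h i) + r w) div M))"
proof -
  have term_eq: "e2pi (\<Sum>w\<in>cube k. s w * real (g (a + M * c +
        (\<Sum>i<k. w i * (\<lambda>i\<in>{..<k}. x i + M * y i) i) + r w))) =
      e2pi (\<Sum>w\<in>cube k. s w * real (g1 ((a + (\<Sum>i<k. w i * x i) + r w) mod M))) *
      e2pi (\<Sum>w\<in>cube k. s w * real (g2 (c + (\<Sum>i<k. w i * y i) +
        (a + (\<Sum>i<k. w i * x i) + r w) div M)))" for a c x y
  proof -
    have "s w * real (g (a + M * c + (\<Sum>i<k. w i * (\<lambda>i\<in>{..<k}. x i + M * y i) i) + r w)) =
        s w * real (g1 ((a + (\<Sum>i<k. w i * x i) + r w) mod M)) +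
        s w * real (g2 (c + (\<Sum>i<k. w i * y i) + (a + (\<Sum>i<k. w i * x i) + r w) div M))" for w
    proof -
      have "(\<Sum>i<k. w i * (\<lambda>i\<in>{..<k}. x i + M * y i) i) =
          (\<Sum>i<k. w i * x i) + M * (\<Sum>i<k. w i * y i)"
        by (simp add: sum_distrib_left sum.distrib[symmetric] algebra_simps)
      then have eq: "a + M * c + (\<Sum>i<k. w i * (\<lambda>i\<in>{..<k}. x i + M * y i) i) + r w =
          (a + (\<Sum>i<k. w i * x i) + r w) + M * (c + (\<Sum>i<k. w i * y i))"
        by (simp add: algebra_simps)
      have gs: "g (u + M * z) = g1 (u mod M) + g2 (z + u div M)" for u z
        using M g[of "u + M * z"] by (simp add: add.commute)
      then show ?thesis
        unfolding eq gs by (simp add: distrib_left)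
    qed
    then show ?thesis
      by (simp add: sum.distrib e2pi_add)
  qed
  have "carry_sum k s g (M * N) r =
    (\<Sum>a<M. \<Sum>c<N. \<Sum>x\<in>{..<k} \<rightarrow>\<^sub>E {..<M}. \<Sum>y\<in>{..<k} \<rightarrow>\<^sub>E {..<N}.
      e2pi (\<Sum>w\<in>cube k. s w * real (g1 ((a + (\<Sum>i<k. w i * x i) + r w) mod M))) *
      e2pi (\<Sum>w\<in>cube k. s w * real (g2 (c + (\<Sum>i<k. w i * y i) +
        (a + (\<Sum>i<k. w i * x i) + r w) div M))))"
    unfolding carry_sum_def sum_lessThan_mult[OF M] sum_PiE_lessThan_mult[OF M] term_eq ..
  also have "\<dots> = (\<Sum>a<M. \<Sum>x\<in>{..<k} \<rightarrow>\<^sub>E {..<M}. \<Sum>c<N. \<Sum>y\<in>{..<k} \<rightarrow>\<^sub>E {..<N}.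
      e2pi (\<Sum>w\<in>cube k. s w * real (g1 ((a + (\<Sum>i<k. w i * x i) + r w) mod M))) *
      e2pi (\<Sum>w\<in>cube k. s w * real (g2 (c + (\<Sum>i<k. w i * y i) +
        (a + (\<Sum>i<k. w i * x i) + r w) div M))))"
    by (intro sum.cong[OF refl] sum.swap)
  finally show ?thesis
    by (simp add: carry_sum_def sum_distrib_left)
qed

lemma norm_carry_sum_le: "norm (carry_sum k s g N r) \<le> real (N ^ (k + 1))"
proof -
  have "norm (carry_sum k s g N r) \<le> (\<Sum>n<N. \<Sum>h\<in>{..<k} \<rightarrow>\<^sub>E {..<N}. 1)"
    unfolding carry_sum_def by (intro order.trans[OF norm_sum] sum_mono) simp
  then show ?thesis
    by (simp add: card_PiE)
qed

text \<open>Carries up to \<open>k\<close> reproduce themselves: the largest possible total is (M -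
  1) + k (M - 1) + k = (k + 1) M - 1.\<close>

lemma carry_le:
  fixes M :: nat
  assumes "n < M" "h \<in> {..<k} \<rightarrow>\<^sub>E {..<M}" "w \<in> cube k" "r \<le> k"
  shows "(n + (\<Sum>i<k. w i * h i) + r) div M \<le> k"
proof -
  have "w i * h i \<le> M - 1" if "i < k" for i
  proof -
    have "w i \<in> {0, 1}" "h i < M"
      using assms(2,3) that by (auto dest: PiE_mem)
    then show ?thesis
      by auto
  qed
  then have "(\<Sum>i<k. w i * h i) \<le> k * (M - 1)"
    using sum_bounded_above[of "{..<k}" "\<lambda>i. w i * h i" "M - 1"] by simp
  moreover have "k * M = k * (M - 1) + k"
    using assms(1) by (cases M) auto
  ultimately have "n + (\<Sum>i<k. w i * h i) + r < (k + 1) * M"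
    using assms by simp
  then show ?thesis
    by (metis less_mult_imp_div_less Suc_eq_plus1 less_Suc_eq_le)
qed

text \<open>The low parts \<open>x j\<close> all send the same carry \<open>c\<close> upwards, so
  their inner sums coincide and can be factored out, leaving the phase sum that vanishes. Every
  other low part is estimated trivially by \<open>B\<close>.\<close>

lemma carry_sum_step:
  fixes M N k :: nat and x :: "'a \<Rightarrow> nat \<times> (nat \<Rightarrow> nat)"
  assumes M: "M > 0"
    and g: "\<And>m. g m = g1 (m mod M) + g2 (m div M)"
    and r: "\<And>w. w \<in> cube k \<Longrightarrow> r w \<le> k"
    and B: "\<And>r. (\<And>w. w \<in> cube k \<Longrightarrow> r w \<le> k) \<Longrightarrow> norm (carry_sum k s g2 N r) \<le> B"
    and J: "finite J" "J \<noteq> {}"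
    and inj: "inj_on x J"
    and x: "\<And>j. j \<in> J \<Longrightarrow> x j \<in> {..<M} \<times> ({..<k} \<rightarrow>\<^sub>E {..<M})"
    and car: "\<And>j w. j \<in> J \<Longrightarrow> w \<in> cube k \<Longrightarrow>
        (fst (x j) + (\<Sum>i<k. w i * snd (x j) i) + r w) div M = c w"
    and cancel: "(\<Sum>j\<in>J. e2pi (\<Sum>w\<in>cube k. s w *
        real (g1 ((fst (x j) + (\<Sum>i<k. w i * snd (x j) i) + r w) mod M)))) = 0"
  shows "norm (carry_sum k s g (M * N) r) \<le> (real (M ^ (k + 1)) - 1) * B"
proof -
  define D where "D = {..<M} \<times> ({..<k} \<rightarrow>\<^sub>E {..<M})"
  define p where "p = (\<lambda>y :: nat \<times> (nat \<Rightarrow> nat). e2pi (\<Sum>w\<in>cube k. s w *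
        real (g1 ((fst y + (\<Sum>i<k. w i * snd y i) + r w) mod M))))"
  define S where "S = (\<lambda>y. carry_sum k s g2 N (\<lambda>w. (fst y + (\<Sum>i<k. w i * snd y i) + r w) div M))"
  have fD: "finite D"
    by (simp add: D_def finite_PiE)
  have cD: "card D = M ^ (k + 1)"
    by (simp add: D_def card_PiE card_cartesian_product)
  have sub: "x ` J \<subseteq> D"
    using x unfolding D_def by blast
  have "B \<ge> 0"
    using B[of "\<lambda>_. 0"] norm_ge_zero order.trans by blast
  have SJ: "S (x j) = carry_sum k s g2 N c" if "j \<in> J" for j
    using car[OF that] unfolding S_def carry_sum_def by simp
  have "(\<Sum>y\<in>x ` J. p y * S y) = (\<Sum>j\<in>J. p (x j) * S (x j))"
    using inj by (simp add: sum.reindex)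
  also have "\<dots> = (\<Sum>j\<in>J. p (x j)) * carry_sum k s g2 N c"
    using SJ by (simp add: sum_distrib_right)
  also have "\<dots> = 0"
    using cancel by (simp add: p_def)
  finally have zero: "(\<Sum>y\<in>x ` J. p y * S y) = 0" .
  have "carry_sum k s g (M * N) r = (\<Sum>y\<in>D. p y * S y)"
    unfolding carry_sum_split[of M g g1 g2, OF M g] D_def p_def S_def
    by (simp add: sum.cartesian_product case_prod_beta)
  also have "\<dots> = (\<Sum>y\<in>D - x ` J. p y * S y)"
    using sum.subset_diff[OF sub fD, of "\<lambda>y. p y * S y"] zero by simp
  finally have "norm (carry_sum k s g (M * N) r) \<le> (\<Sum>y\<in>D - x ` J. norm (p y * S y))"
    by (simp add: norm_sum)
  also have "\<dots> \<le> (\<Sum>y\<in>D - x ` J. B)"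
  proof (rule sum_mono)
    fix y assume "y \<in> D - x ` J"
    then have "fst y < M" "snd y \<in> {..<k} \<rightarrow>\<^sub>E {..<M}"
      by (auto simp: D_def)
    then have "norm (S y) \<le> B"
      unfolding S_def using r by (intro B carry_le) auto
    then show "norm (p y * S y) \<le> B"
      by (simp add: norm_mult p_def)
  qed
  also have "\<dots> = real (card (D - x ` J)) * B"
    by simp
  also have "\<dots> \<le> (real (M ^ (k + 1)) - 1) * B"
  proof (rule mult_right_mono)
    have "card (D - x ` J) < card D"
      using sub J fD by (intro psubset_card_mono) auto
    then show "real (card (D - x ` J)) \<le> real (M ^ (k + 1)) - 1"
      unfolding cD by linarith
  qed fact
  finally show ?thesis .
qed

section \<open>The resonant digits\<close>

lemma sum_cube_Suc:
  fixes f :: "(nat \<Rightarrow> nat) \<Rightarrow> 'a :: comm_monoid_add"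
  shows "(\<Sum>w\<in>cube (Suc k). f w) = (\<Sum>w\<in>cube k. f (w(k := 0)) + f (w(k := 1)))"
proof -
  have "(\<Sum>w\<in>cube (Suc k). f w) = (\<Sum>(a, w)\<in>{0, 1} \<times> cube k. f (w(k := a)))"
    unfolding lessThan_Suc PiE_insert_eq
    by (subst sum.reindex[OF inj_combinator]) (auto simp: case_prod_beta)
  also have "\<dots> = (\<Sum>w\<in>cube k. f (w(k := 0)) + f (w(k := 1)))"
    by (simp add: sum.cartesian_product[symmetric] sum.distrib)
  finally show ?thesis .
qed

lemma sum_fun_upd_lessThan: "(\<Sum>i<k. (w(k := a)) i) = (\<Sum>i<k :: nat. w i :: nat)"
  by (intro sum.cong) auto

lemma sum_binary_le:
  fixes w :: "nat \<Rightarrow> nat"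
  assumes "\<And>i. i < k \<Longrightarrow> w i \<in> {0, 1}"
  shows "(\<Sum>i<k. w i) \<le> k"
  using sum_bounded_above[of "{..<k}" w 1] assms by fastforce

lemma alternating_cube_sum:
  assumes "k > 0"
  shows "(\<Sum>w\<in>cube k. (-1) ^ (\<Sum>i<k. w i) :: real) = 0"
proof -
  obtain m where "k = Suc m"
    using assms not0_implies_Suc by blast
  then show ?thesis
    unfolding \<open>k = Suc m\<close> sum_cube_Suc sum.lessThan_Suc sum_fun_upd_lessThan by simp
qed

text \<open>As the signs add up to zero, \<open>f\<close> may be replaced by \<open>f - A\<close>,
  which vanishes at every vertex but one.\<close>

lemma alternating_cube_sum_single:
  assumes "k > 0"
    and f: "\<And>w. w \<in> cube k \<Longrightarrow> w \<noteq> (\<lambda>i\<in>{..<k}. 1) \<Longrightarrow> f w = A"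
  shows "(\<Sum>w\<in>cube k. (-1) ^ (\<Sum>i<k. w i) * f w :: real) = (-1) ^ k * (f (\<lambda>i\<in>{..<k}. 1) - A)"
proof -
  let ?o = "\<lambda>i\<in>{..<k}. 1 :: nat"
  have fin: "finite (cube k)" by (simp add: finite_PiE)
  have o: "?o \<in> cube k" by auto
  have "(\<Sum>w\<in>cube k. (-1) ^ (\<Sum>i<k. w i) * f w) =
      (\<Sum>w\<in>cube k. (-1) ^ (\<Sum>i<k. w i) * (f w - A)) + A * (\<Sum>w\<in>cube k. (-1) ^ (\<Sum>i<k. w i))"
    by (simp add: sum_distrib_left sum.distrib[symmetric] algebra_simps)
  also have "\<dots> = (\<Sum>w\<in>cube k. (-1) ^ (\<Sum>i<k. w i) * (f w - A))"
    using alternating_cube_sum[OF assms(1)] by simp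
  also have "\<dots> = (\<Sum>w\<in>{?o}. (-1) ^ (\<Sum>i<k. w i) * (f w - A))"
    using fin o f by (intro sum.mono_neutral_right) auto
  finally show ?thesis by simp
qed

text \<open>
  All the sums \<open>n + w \<cdot> h\<close> here are at most \<open>q ^ Suc k\<close>, and the top direction
  raises the leading digit by one, except for \<open>w = (1, \<dots>, 1)\<close>, where it produces a carry.
\<close>
lemma resonant_digits:
  fixes q k :: nat
  assumes q: "q \<ge> 2" and k: "k > 0"
  defines "n \<equiv> q ^ Suc k - q ^ k - k"
    and "h \<equiv> (\<lambda>i\<in>{..<Suc k}. if i = k then q ^ k else 1)"
  shows "w \<in> cube (Suc k) \<Longrightarrow> n + (\<Sum>i<Suc k. w i * h i) \<le> q ^ Suc k"
    and "(\<Sum>w\<in>cube (Suc k). (-1) ^ (\<Sum>i<Suc k. w i) *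
            real (digit_sum q (n + (\<Sum>i<Suc k. w i * h i)))) = (-1) ^ k * (real q - 1)"
proof -
  have "k < 2 ^ k" by (rule less_exp)
  also have "(2::nat) ^ k \<le> q ^ k" using q by (intro power_mono) auto
  finally have kq: "k < q ^ k" .
  \<comment> \<open>Hence the subtractions in \<open>n\<close> are exact: n = (q - 1) q^k - k lies
    exactly \<open>k\<close> unit steps below (q - 1) q^k.\<close>
  have "2 * q ^ k \<le> q ^ Suc k" using q by simp
  then have n: "n + k + q ^ k = q ^ Suc k" using kq unfolding n_def by linarith
  have sp: "n + (\<Sum>i<Suc k. w i * h i) = n + (\<Sum>i<k. w i) + w k * q ^ k" for w
    by (simp add: h_def)
  show "n + (\<Sum>i<Suc k. w i * h i) \<le> q ^ Suc k" if "w \<in> cube (Suc k)"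
  proof -
    have "(\<Sum>i<k. w i) \<le> k"
      using that by (intro sum_binary_le) (auto simp: PiE_iff)
    moreover have "w k * q ^ k \<le> q ^ k"
      using PiE_mem[OF that, of k] by auto
    ultimately show ?thesis unfolding sp using n by linarith
  qed
  \<comment> \<open>The value at w k = 0 minus the value at w k = 1, because the sign flips with the
    last coordinate.\<close>
  define f where "f = (\<lambda>w. real (digit_sum q (n + (\<Sum>i<k. w i))) - real (digit_sum q (n + (\<Sum>i<k. w i) + q ^ k)))"
  have fA: "f w = -1" if w: "w \<in> cube k" and neq: "w \<noteq> (\<lambda>i\<in>{..<k}. 1)" for w
  proof -
    define u where "u = n + (\<Sum>i<k. w i)"
    obtain i0 where "i0 < k" "w i0 \<noteq> 1"
    proof (rule ccontr)
      assume "\<not> thesis"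
      with that have "\<forall>i<k. w i = 1" by blast
      with w have "w = (\<lambda>i\<in>{..<k}. 1)" by (auto simp: PiE_iff extensional_def)
      with neq show False by blast
    qed
    moreover have "w i \<le> 1" if "i < k" for i
      using PiE_mem[OF w, of i] that by auto
    ultimately have "(\<Sum>i<k. w i) < (\<Sum>i<k. 1)"
      by (intro sum_strict_mono_ex1) (auto simp: order_less_le intro!: bexI[of _ i0])
    \<comment> \<open>While a unit step is missing, the leading digit is below q - 1, so adding
      \<open>q ^ k\<close> raises it by one without a carry.\<close>
    then have "u < q ^ k * (q - 1)"
      using n unfolding u_def by (simp add: algebra_simps)
    then have d: "u div q ^ k < q - 1"
      by (simp add: less_mult_imp_div_less mult.commute)
    have m: "u mod q ^ k < q ^ k" using q by simp
    have "digit_sum q u = digit_sum q (u mod q ^ k) + u div q ^ k"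
      using digit_sum_split[OF q m, of "u div q ^ k"] d by (simp add: digit_sum_less[OF q])
    moreover have "digit_sum q (u + q ^ k) = digit_sum q (u mod q ^ k) + Suc (u div q ^ k)"
    proof -
      have "u + q ^ k = u mod q ^ k + q ^ k * Suc (u div q ^ k)" by simp
      then show ?thesis
        using digit_sum_split[OF q m, of "Suc (u div q ^ k)"] d by (simp add: digit_sum_less[OF q])
    qed
    ultimately show ?thesis unfolding f_def u_def by simp
  qed
  \<comment> \<open>With all unit steps taken, (q - 1) q^k has digit sum q - 1, whereas adding q^k
    gives q^(k+1) with digit sum 1. The excess over the generic value -1 is q - 1.\<close>
  have top: "f (\<lambda>i\<in>{..<k}. 1) = real q - 2"
  proof -
    have z: "0 < q ^ k" "0 < q ^ Suc k" using q by auto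
    have nk: "n + k = 0 + q ^ k * (q - 1)"
      using n by (simp add: algebra_simps)
    have "digit_sum q (n + k) = q - 1"
      unfolding nk digit_sum_split[OF q z(1)] using q by (simp add: digit_sum_less)
    moreover have "digit_sum q (n + k + q ^ k) = 1"
      using digit_sum_split[OF q z(2), of 1] q n by (simp add: digit_sum_less)
    ultimately show ?thesis using q unfolding f_def by (simp add: of_nat_diff)
  qed
  have "(\<Sum>w\<in>cube (Suc k). (-1) ^ (\<Sum>i<Suc k. w i) *
            real (digit_sum q (n + (\<Sum>i<Suc k. w i * h i)))) =
        (\<Sum>w\<in>cube k. (-1) ^ (\<Sum>i<k. w i) * f w)"
    unfolding sum_cube_Suc sp by (simp add: sum_fun_upd_lessThan f_def algebra_simps)
  also have "\<dots> = (-1) ^ k * (real q - 1)"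
    using alternating_cube_sum_single[OF k, of f "-1"] fA top by simp
  finally show "(\<Sum>w\<in>cube (Suc k). (-1) ^ (\<Sum>i<Suc k. w i) *
            real (digit_sum q (n + (\<Sum>i<Suc k. w i * h i)))) = (-1) ^ k * (real q - 1)" .
qed

text \<open>Scaling the resonant \<open>n\<close> and \<open>h\<close> by \<open>q ^ K * G j\<close>
  puts \<open>j\<close> copies of the digits of \<open>v w\<close> above the incoming carry
  \<open>r w\<close>, by linearity for all \<open>w\<close> at once. Thus
  \<open>carry_sum_step\<close> applies to the points \<open>x j\<close> with outgoing carry
  0.\<close>

lemma carry_sum_block:
  fixes q k b l K :: nat
  assumes k: "k \<ge> 2" and q: "q \<ge> 2" and cop: "gcd b (q - 1) = 1" and l: "0 < l" "l < b"
    and K: "k < q ^ K"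
  defines "M \<equiv> q ^ (K + (k + 1) * b)"
    and "s \<equiv> (\<lambda>w. real l / real b * (-1) ^ (\<Sum>i<k. w i))"
  assumes g: "\<And>m. g m = digit_sum q (m mod M) + g2 (m div M)"
    and r: "\<And>w. w \<in> cube k \<Longrightarrow> r w \<le> k"
    and B: "\<And>r. (\<And>w. w \<in> cube k \<Longrightarrow> r w \<le> k) \<Longrightarrow> norm (carry_sum k s g2 N r) \<le> B"
  shows "norm (carry_sum k s g (M * N) r) \<le> (real (M ^ (k + 1)) - 1) * B"
proof -
  \<comment> \<open>\<open>resonant_digits\<close> splits off one direction of the cube and needs at
    least one more, hence \<open>k \<ge> 2\<close>.\<close>
  obtain k' where k': "k = Suc k'" "k' > 0"
    using k by (cases k) auto
  define n where "n = q ^ Suc k' - q ^ k' - k'"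
  define h where "h = (\<lambda>i\<in>{..<Suc k'}. if i = k' then q ^ k' else 1)"
  define v where "v = (\<lambda>w. n + (\<Sum>i<k. w i * h i))"
  define G where "G = (\<lambda>j. \<Sum>t<j. (q ^ (k + 1)) ^ t)"
  define x where "x = (\<lambda>j. (q ^ K * (G j * n), \<lambda>i\<in>{..<k}. q ^ K * (G j * h i)))"
  define \<theta> where "\<theta> = real l / real b * ((-1) ^ k' * (real q - 1))"
  have v: "v w \<le> q ^ k" if "w \<in> cube k" for w
    using resonant_digits(1)[OF q k'(2)] that unfolding v_def n_def h_def k'(1) by blast
  have a: "(\<Sum>w\<in>cube k. (-1) ^ (\<Sum>i<k. w i) * real (digit_sum q (v w))) = (-1) ^ k' * (real q - 1)"
    using resonant_digits(2)[OF q k'(2)] unfolding v_def n_def h_def k'(1) .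
  \<comment> \<open>\<open>v w\<close> can equal \<open>q ^ k\<close>, which has k + 1 digits; this
    fixes the width of a group.\<close>
  have qk: "q ^ k < q ^ (k + 1)"
    using q by simp
  have G: "G j * u < (q ^ (k + 1)) ^ j" "digit_sum q (G j * u) = j * digit_sum q u"
    if "u \<le> q ^ k" for j u
    using digit_sum_repeat[OF q le_less_trans[OF that qk], of j] unfolding G_def by blast+
  \<comment> \<open>At most \<open>b\<close> groups above the lowest \<open>K\<close> digits are
    filled, so the total stays below \<open>M\<close> and nothing is carried out.\<close>
  have low: "r' + q ^ K * (G j * u) < M" if "u \<le> q ^ k" "j < b" "r' < q ^ K" for r' j u
  proof -
    have "(q ^ (k + 1)) ^ j \<le> (q ^ (k + 1)) ^ b"
      using that q by (intro power_increasing) auto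
    then have "Suc (G j * u) \<le> q ^ ((k + 1) * b)"
      using G(1)[OF that(1), of j] unfolding power_mult by linarith
    moreover have "r' + q ^ K * (G j * u) < q ^ K * Suc (G j * u)"
      using that by simp
    ultimately show ?thesis
      unfolding M_def power_add using mult_le_mono2 order_less_le_trans by blast
  qed
  have xsum: "fst (x j) + (\<Sum>i<k. w i * snd (x j) i) + r w = r w + q ^ K * (G j * v w)" for j w
    unfolding x_def v_def by (simp add: sum_distrib_left algebra_simps)
  have rK: "r w < q ^ K" if "w \<in> cube k" for w
    using r[OF that] K by simp
  have phase: "digit_sum q ((r w + q ^ K * (G j * v w)) mod M) = digit_sum q (r w) + j * digit_sum q (v w)"
    if "j < b" "w \<in> cube k" for j w
    using low[OF v that(1) rK] digit_sum_split[OF q rK] G(2)[OF v] that by simp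
  have hle: "h i \<le> q ^ k" if "i < k" for i
    using q k' that by (auto simp: h_def)
  have nle: "n \<le> q ^ k"
    unfolding n_def k'(1) by simp
  have qK: "0 < q ^ K"
    using q by simp
  show ?thesis
  proof (rule carry_sum_step[where g = g and ?g1.0 = "digit_sum q" and ?g2.0 = g2 and J = "{..<b}" and x = x
        and c = "\<lambda>_. 0"])
    show "M > 0" using q by (simp add: M_def)
    show "{..<b} \<noteq> {}" using l by (auto simp: lessThan_empty_iff)
    have "strict_mono G"
      unfolding strict_mono_Suc_iff G_def using q by simp
    show "inj_on x {..<b}"
    proof (rule inj_onI)
      fix i j assume "x i = x j"
      \<comment> \<open>Coordinate \<open>k'\<close> suffices: there \<open>h\<close> is the
        positive number \<open>q ^ k'\<close>, so \<open>G j\<close> can be recovered.\<close>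
      then have "(\<lambda>m\<in>{..<k}. q ^ K * (G i * h m)) k' = (\<lambda>m\<in>{..<k}. q ^ K * (G j * h m)) k'"
        by (simp add: x_def)
      then have "G i = G j"
        using q by (simp add: k' h_def)
      then show "i = j"
        using \<open>strict_mono G\<close> by (simp add: strict_mono_eq)
    qed
    show "x j \<in> {..<M} \<times> ({..<k} \<rightarrow>\<^sub>E {..<M})" if "j \<in> {..<b}" for j
      using low[OF nle _ qK, of j] low[OF hle _ qK, of _ j] that by (auto simp: x_def)
    show "(fst (x j) + (\<Sum>i<k. w i * snd (x j) i) + r w) div M = 0" if "j \<in> {..<b}" "w \<in> cube k" for j w
      unfolding xsum using low[OF v _ rK] that by simp
    define z where "z = e2pi (\<Sum>w\<in>cube k. s w * real (digit_sum q (r w)))"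
    have "e2pi (\<Sum>w\<in>cube k. s w *
        real (digit_sum q ((fst (x j) + (\<Sum>i<k. w i * snd (x j) i) + r w) mod M))) = z * e2pi \<theta> ^ j"
      if "j < b" for j
    proof -
      have "(\<Sum>w\<in>cube k. s w * real (digit_sum q ((r w + q ^ K * (G j * v w)) mod M))) =
          (\<Sum>w\<in>cube k. s w * real (digit_sum q (r w)) + real j * (s w * real (digit_sum q (v w))))"
        using phase[OF that] by (intro sum.cong) (auto simp: algebra_simps)
      also have "\<dots> = (\<Sum>w\<in>cube k. s w * real (digit_sum q (r w))) +
          real j * (\<Sum>w\<in>cube k. s w * real (digit_sum q (v w)))"
        by (simp add: sum.distrib sum_distrib_left)
      also have "(\<Sum>w\<in>cube k. s w * real (digit_sum q (v w))) = \<theta>"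
        unfolding \<theta>_def a[symmetric] s_def by (simp add: sum_distrib_left mult.assoc)
      finally show ?thesis
        unfolding xsum by (simp add: e2pi_add z_def e2pi_of_nat_mult)
    qed
    then have "(\<Sum>j<b. e2pi (\<Sum>w\<in>cube k. s w *
        real (digit_sum q ((fst (x j) + (\<Sum>i<k. w i * snd (x j) i) + r w) mod M)))) =
        z * (\<Sum>j<b. e2pi \<theta> ^ j)"
      by (simp add: sum_distrib_left)
    also have "(\<Sum>j<b. e2pi \<theta> ^ j) = 0"
    proof (rule geometric_sum_root_of_unity)
      have th: "real b * \<theta> = of_int ((-1) ^ k' * int l * (int q - 1))"
        using l by (simp add: \<theta>_def)
      show "e2pi \<theta> ^ b = 1"
        unfolding e2pi_of_nat_mult[symmetric] e2pi_eq_1_iff th by (rule Ints_of_int)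
      show "e2pi \<theta> \<noteq> 1"
      proof
        \<comment> \<open>An integer \<open>\<theta>\<close> would make \<open>b\<close> divide l (q
          - 1) up to sign, hence divide \<open>l\<close> by coprimality, against 0 < l < b.\<close>
        assume "e2pi \<theta> = 1"
        then obtain m where "\<theta> = of_int m"
          unfolding e2pi_eq_1_iff by (auto elim: Ints_cases)
        then have "real_of_int (int b * m) = of_int ((-1) ^ k' * int l * (int q - 1))"
          using th by simp
        then have "int b * m = (-1) ^ k' * int l * (int q - 1)"
          unfolding of_int_eq_iff .
        then have "int b dvd (-1) ^ k' * (int l * (int q - 1))"
          by (metis dvd_triv_left mult.assoc)
        then have "int b dvd int l * (int q - 1)"
          by (cases "even k'") auto
        also have "int l * (int q - 1) = int (l * (q - 1))"
          using q by (simp add: of_nat_diff)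
        finally have "b dvd l * (q - 1)"
          by (simp only: int_dvd_int_iff)
        then have "b dvd l"
          using cop by (simp add: coprime_dvd_mult_left_iff coprime_iff_gcd_eq_1)
        then show False
          using l nat_dvd_not_less by blast
      qed
    qed
    finally show "(\<Sum>j<b. e2pi (\<Sum>w\<in>cube k. s w *
        real (digit_sum q ((fst (x j) + (\<Sum>i<k. w i * snd (x j) i) + r w) mod M)))) = 0"
      by simp
    show "g m = digit_sum q (m mod M) + g2 (m div M)" for m
      by (rule g)
    show "r w \<le> k" if "w \<in> cube k" for w
      using that by (rule r)
    show "norm (carry_sum k s g2 N r') \<le> B" if "\<And>w. w \<in> cube k \<Longrightarrow> r' w \<le> k" for r'
      using that by (rule B)
  qed simp
qed

section \<open>Iteration over the blocks and the asymptotic bound\<close>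

text \<open>Induction on the number \<open>t\<close> of full blocks, for all admissible carries
  simultaneously, since each block changes them. The \<open>u\<close> leftover digits are bounded
  trivially. \<open>g\<close> is indexed by the number of digits left because truncation shortens
  with every block.\<close>

lemma carry_sum_bound:
  fixes q k b l K :: nat
  assumes k: "k \<ge> 2" and q: "q \<ge> 2" and cop: "gcd b (q - 1) = 1" and l: "0 < l" "l < b"
    and K: "k < q ^ K"
  defines "L \<equiv> K + (k + 1) * b"
    and "s \<equiv> (\<lambda>w. real l / real b * (-1) ^ (\<Sum>i<k. w i))"
  assumes g: "\<And>\<rho> m. g (L + \<rho>) m = trunc_digit_sum q L m + g \<rho> (m div q ^ L)"
    and r: "\<And>w. w \<in> cube k \<Longrightarrow> r w \<le> k"
  shows "norm (carry_sum k s (g (t * L + u)) (q ^ (t * L + u)) r) \<le>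
         (real q ^ ((k + 1) * L) - 1) ^ t * real q ^ ((k + 1) * u)"
  using r
proof (induction t arbitrary: r)
  case 0
  show ?case
    using norm_carry_sum_le[of k s "g u" "q ^ u" r]
    by (simp add: power_mult[symmetric] mult.commute del: power_Suc)
next
  case (Suc t)
  have "norm (carry_sum k s (g (Suc t * L + u)) (q ^ L * q ^ (t * L + u)) r) \<le>
      (real ((q ^ L) ^ (k + 1)) - 1) * ((real q ^ ((k + 1) * L) - 1) ^ t * real q ^ ((k + 1) * u))"
  proof (rule carry_sum_block[OF k q cop l K, folded L_def s_def])
    show "g (Suc t * L + u) m = digit_sum q (m mod q ^ L) + g (t * L + u) (m div q ^ L)" for m
      using g[of "t * L + u" m] by (simp add: trunc_digit_sum_def add.assoc)
    show "r w \<le> k" if "w \<in> cube k" for w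
      using that by (rule Suc.prems)
    show "norm (carry_sum k s (g (t * L + u)) (q ^ (t * L + u)) r') \<le>
        (real q ^ ((k + 1) * L) - 1) ^ t * real q ^ ((k + 1) * u)"
      if "\<And>w. w \<in> cube k \<Longrightarrow> r' w \<le> k" for r'
      using that by (rule Suc.IH)
  qed
  then show ?case
    by (simp add: power_add power_mult[symmetric] mult_ac)
qed

text \<open>After normalization the bound is (1 - 1/D)^t, at most exp (-t/D). Since t + 1 is at
  least \<rho> / L, rounding down costs only the constant factor exp (1/D).\<close>

lemma carry_sum_bigo:
  fixes q k b l K :: nat
  assumes k: "k \<ge> 2" and q: "q \<ge> 2" and cop: "gcd b (q - 1) = 1" and l: "0 < l" "l < b"
    and K: "k < q ^ K"
  defines "L \<equiv> K + (k + 1) * b"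
    and "s \<equiv> (\<lambda>w. real l / real b * (-1) ^ (\<Sum>i<k. w i))"
  assumes g: "\<And>\<rho> m. g (L + \<rho>) m = trunc_digit_sum q L m + g \<rho> (m div q ^ L)"
  shows "(\<lambda>\<rho>. norm (1 / of_nat (q ^ ((k + 1) * \<rho>)) * carry_sum k s (g \<rho>) (q ^ \<rho>) (\<lambda>_. 0)))
      \<in> O(\<lambda>\<rho>. exp (- (real \<rho> / (real L * real q ^ ((k + 1) * L)))))"
proof (rule bigoI[where c = "exp (1 / real q ^ ((k + 1) * L))"], rule always_eventually, rule allI)
  fix \<rho>
  define D where "D = real q ^ ((k + 1) * L)"
  define t where "t = \<rho> div L"
  define u where "u = \<rho> mod L"
  have L: "L > 0" using k l by (simp add: L_def)
  have \<rho>: "\<rho> = t * L + u" by (simp add: t_def u_def)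
  have D: "D \<ge> 1" using q by (simp add: D_def)
  have qD: "real q ^ ((k + 1) * \<rho>) = D ^ t * real q ^ ((k + 1) * u)"
    unfolding \<rho> D_def power_mult[symmetric] power_add[symmetric]
    by (rule arg_cong[of _ _ "power (real q)"]) (simp add: algebra_simps)
  have "norm (1 / of_nat (q ^ ((k + 1) * \<rho>)) * carry_sum k s (g \<rho>) (q ^ \<rho>) (\<lambda>_. 0)) =
      norm (carry_sum k s (g \<rho>) (q ^ \<rho>) (\<lambda>_. 0)) / real q ^ ((k + 1) * \<rho>)"
    by (simp add: norm_mult norm_divide norm_power)
  also have "\<dots> \<le> ((D - 1) ^ t * real q ^ ((k + 1) * u)) / real q ^ ((k + 1) * \<rho>)"
    unfolding D_def using carry_sum_bound[OF k q cop l K, folded L_def s_def, of g "\<lambda>_. 0" t u] g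
    by (intro divide_right_mono) (simp_all only: \<rho>[symmetric] zero_le zero_le_power of_nat_0_le_iff)
  also have "\<dots> = (1 - 1 / D) ^ t"
    unfolding qD using q D by (simp add: power_divide[symmetric] diff_divide_distrib)
  also have "\<dots> \<le> exp (- (1 / D)) ^ t"
    using D exp_ge_add_one_self[of "- (1 / D)"] by (intro power_mono) auto
  also have "\<dots> = exp (- (real t / D))"
    by (simp add: exp_of_nat_mult[symmetric])
  also have "\<dots> \<le> exp (1 / D - real \<rho> / (real L * D))"
  proof -
    have "u \<le> L"
      using L by (simp add: u_def)
    then have "real \<rho> \<le> (real t + 1) * real L"
      by (subst \<rho>) (simp add: distrib_right)
    then have "real \<rho> / (real L * D) \<le> ((real t + 1) * real L) / (real L * D)"
      using D by (intro divide_right_mono) auto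
    also have "\<dots> = real t / D + 1 / D"
      using L by (simp add: add_divide_distrib)
    finally show ?thesis by simp
  qed
  also have "\<dots> = exp (1 / D) * exp (- (real \<rho> / (real L * D)))"
    by (simp add: exp_add[symmetric])
  finally show "norm (norm (1 / of_nat (q ^ ((k + 1) * \<rho>)) * carry_sum k s (g \<rho>) (q ^ \<rho>) (\<lambda>_. 0))) \<le>
      exp (1 / real q ^ ((k + 1) * L)) * norm (exp (- (real \<rho> / (real L * real q ^ ((k + 1) * L)))))"
    by (simp add: D_def)
qed

text \<open>This is why \<open>K\<close> is chosen so: every carry, being at most \<open>k\<close>,
  fits into \<open>K\<close> base-q digits.\<close>

lemma less_power_floor_log:
  assumes "k > 0" "q \<ge> 2"
  shows "k < q ^ (nat \<lfloor>ln (real k) / ln (real q)\<rfloor> + 1)"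
proof -
  define K where "K = nat \<lfloor>ln (real k) / ln (real q)\<rfloor> + 1"
  have q: "ln (real q) > 0" using assms by simp
  have "ln (real k) / ln (real q) \<ge> 0" using assms by simp
  then have "ln (real k) / ln (real q) < real K"
    unfolding K_def by linarith
  then have "ln (real k) < real K * ln (real q)"
    using q by (simp add: pos_divide_less_eq)
  also have "\<dots> = ln (real q ^ K)"
    using assms by (simp add: ln_realpow)
  finally have "real k < real (q ^ K)"
    using assms by simp
  then show ?thesis
    unfolding K_def of_nat_less_iff .
qed

theorem theorem7:
  fixes k q b l K :: nat and \<eta>\<^sub>0 :: real
  assumes "k \<ge> 3" and "q \<ge> 2" and "gcd b (q - 1) = 1" and "0 < l" and "l < b"
    and "K = nat \<lfloor>ln (real k) / ln (real q)\<rfloor> + 1"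
    and "\<eta>\<^sub>0 = 1 / (ln (real q) * real (K + (k + 1) * b)
                  * real q ^ ((k + 1) * (K + b * (k + 1))))"
  shows "(\<lambda>\<rho>::nat. norm (1 / of_nat (q ^ ((k + 1) * \<rho>)) *
            (\<Sum>n<q ^ \<rho>. \<Sum>h\<in>{..<k} \<rightarrow>\<^sub>E {..<q ^ \<rho>}.
               e2pi (real l / real b *
                  (\<Sum>w\<in>{..<k} \<rightarrow>\<^sub>E {0, 1}.
                     (- 1) ^ digit_sum 2 (\<Sum>i<k. w i * 2 ^ i) *
                     real (digit_sum q (n + (\<Sum>i<k. w i * h i))))))))
           \<in> O(\<lambda>\<rho>. real q powr (- \<eta>\<^sub>0 * real \<rho>))
       \<and> (\<lambda>\<rho>::nat. norm (1 / of_nat (q ^ ((k + 1) * \<rho>)) *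
            (\<Sum>n<q ^ \<rho>. \<Sum>h\<in>{..<k} \<rightarrow>\<^sub>E {..<q ^ \<rho>}.
               e2pi (real l / real b *
                  (\<Sum>w\<in>{..<k} \<rightarrow>\<^sub>E {0, 1}.
                     (- 1) ^ digit_sum 2 (\<Sum>i<k. w i * 2 ^ i) *
                     real (trunc_digit_sum q \<rho> (n + (\<Sum>i<k. w i * h i))))))))
           \<in> O(\<lambda>\<rho>. real q powr (- \<eta>\<^sub>0 * real \<rho>))"
proof -
  have k: "k \<ge> 2" "k > 0" using assms(1) by auto
  have K: "k < q ^ K"
    using less_power_floor_log[OF k(2) assms(2)] assms(6) by simp
  define L where "L = K + (k + 1) * b"
  define s where "s = (\<lambda>w. real l / real b * (-1) ^ (\<Sum>i<k. w i :: nat))"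
  \<comment> \<open>The factor ln q in the denominator of \<open>\<eta>\<^sub>0\<close> cancels the
    one from writing the power of \<open>q\<close> as an exponential.\<close>
  have rate: "real q powr (- \<eta>\<^sub>0 * real \<rho>) = exp (- (real \<rho> / (real L * real q ^ ((k + 1) * L))))" for \<rho>
  proof -
    have "ln (real q) \<noteq> 0" "real q \<noteq> 0" using assms(2) by auto
    moreover have "K + b * (k + 1) = L" by (simp add: L_def)
    ultimately show ?thesis
      unfolding assms(7) powr_def L_def[symmetric] by simp
  qed
  \<comment> \<open>The added 0 is the initial carry, which exposes the shape of
    \<open>carry_sum\<close>.\<close>
  have main: "real l / real b * (\<Sum>w\<in>cube k. (- 1) ^ digit_sum 2 (\<Sum>i<k. w i * 2 ^ i) *
      real (f (n + (\<Sum>i<k. w i * h i)))) =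
      (\<Sum>w\<in>cube k. s w * real (f (n + (\<Sum>i<k. w i * h i) + 0)))" for f :: "nat \<Rightarrow> nat" and n h
  proof -
    have "digit_sum 2 (\<Sum>i<k. w i * 2 ^ i) = (\<Sum>i<k. w i)" if "w \<in> cube k" for w
      using that by (intro digit_sum_2_binary) (auto simp: PiE_iff)
    then show ?thesis
      unfolding s_def sum_distrib_left by (intro sum.cong) auto
  qed
  \<comment> \<open>The first estimate takes for \<open>g\<close> the constant family
    \<open>digit_sum q\<close>, the second takes \<open>trunc_digit_sum q\<close>, indexed by
    \<rho>.\<close>
  show ?thesis
    unfolding main rate carry_sum_def[symmetric, where r = "\<lambda>_. 0"]
    unfolding s_def L_def
    by (intro conjI carry_sum_bigo[OF k(1) assms(2-5) K]
        digit_sum_mod_div[OF assms(2)] trunc_digit_sum_mod_div[OF assms(2)])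
qed

end
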